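(* Let $C_1$ and $C_2$ be clones on $\{0,1\}$ such that $C_1 \subseteq K_1$ and $C_2 \subseteq K_2$ for some pair \[ (K_1,K_2) \in \{ (L, \Lambda), (L_0, U_\infty), (L_1, U_\infty), (LS, U_\infty), (L, V), (L_0, W_\infty), (L_1, W_\infty), (LS, W_\infty) \}. \] Then the set of all $(C_1,C_2)$-clonoids is uncountable.
   Context: Boolean functions are maps $\{0,1\}^n \to \{0,1\}$, $n \geq 1$. For $f$ of arity $n$ and $g_1,\dots,g_n$ of arity $m$, $f(g_1,\dots,g_n)$ is the $m$-ary function $\mathbf{a} \mapsto f(g_1(\mathbf{a}),\dots,g_n(\mathbf{a}))$. For sets $F, G$ of Boolean functions, $FG$ is the set of all functions $f(g_1,\dots,g_n)$ with $f \in F$ $n$-ary and $g_1,\dots,g_n \in G$ all of the same arity. A clone on $\{0,1\}$ is a set $C$ of Boolean functions containing all projections $(a_1,\dots,a_n)\mapsto a_i$ and satisfying $CC \subseteq C$. For clones $C_1, C_2$ on $\{0,1\}$, a $(C_1,C_2)$-clonoid is a set $K$ of Boolean functions with $KC_1 \subseteq K$ and $C_2K \subseteq K$. Clones used: $L$ is the clone generated by $x+y$ (addition mod 2) and the constant $1$, i.e. all functions $x_{i_1}+\dots+x_{i_k}+c$; $L_0 = \{f \in L : f(0,\dots,0)=0\}$; $L_1 = \{f \in L: f(1,\dots,1)=1\}$; $LS = \{f \in L : f \text{ self-dual}\}$, where $f$ is self-dual if $f(\overline{\mathbf{a}}) = \overline{f(\mathbf{a})}$ for all $\mathbf{a}$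 (bar = componentwise complement). $\Lambda$ is the clone generated by $\wedge$ and the constants $0,1$; $V$ is the clone generated by $\vee$ and the constants $0,1$. $U_\infty$ is the set of Boolean functions $f$ such that $\bigwedge T \neq (0,\dots,0)$ for every $T \subseteq f^{-1}(1)$ (componentwise meet, with $\bigwedge \emptyset = (1,\dots,1)$); $W_\infty$ is the set of Boolean functions $f$ such that $\bigvee F \neq (1,\dots,1)$ for every $F \subseteq f^{-1}(0)$ (with $\bigvee\emptyset = (0,\dots,0)$). *)

theory Defs
  imports Main "HOL-Library.FuncSet" "HOL-Library.Countable_Set"
begin

text \<open>
  The truth values 0, 1 are \<^term>\<open>False\<close>, \<^term>\<open>True\<close>, and an \<open>n\<close>-tuple is a list of length \<open>n\<close>.
  A Boolean function carries its arity \<open>n\<close> explicitly; its second component is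
  \<^const>\<open>undefined\<close> off the \<open>n\<close>-tuples, so that functions with the same arity and the same values
  are equal.
\<close>

type_synonym boolfun = "nat \<times> (bool list \<Rightarrow> bool)"

definition tuples :: "nat \<Rightarrow> bool list set" where
  "tuples n = {a. length a = n}"

definition boolfuns :: "boolfun set" where
  "boolfuns = {(n, f). n \<ge> 1 \<and> f \<in> tuples n \<rightarrow>\<^sub>E UNIV}"

abbreviation arity :: "boolfun \<Rightarrow> nat" where
  "arity f \<equiv> fst f"

abbreviation app :: "boolfun \<Rightarrow> bool list \<Rightarrow> bool" where
  "app f \<equiv> snd f"

definition mk :: "nat \<Rightarrow> (bool list \<Rightarrow> bool) \<Rightarrow> boolfun" where
  "mk n f = (n, restrict f (tuples n))"

definition compose_bf :: "nat \<Rightarrow> boolfun \<Rightarrow> boolfun list \<Rightarrow> boolfun" where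
  "compose_bf m f gs = mk m (\<lambda>a. app f (map (\<lambda>g. app g a) gs))"

definition set_comp :: "boolfun set \<Rightarrow> boolfun set \<Rightarrow> boolfun set" where
  "set_comp F G = {compose_bf m f gs | m f gs.
     f \<in> F \<and> length gs = arity f \<and> set gs \<subseteq> G \<and> (\<forall>g \<in> set gs. arity g = m)}"

definition proj :: "nat \<Rightarrow> nat \<Rightarrow> boolfun" where
  "proj n i = mk n (\<lambda>a. a ! i)"

definition clone :: "boolfun set \<Rightarrow> bool" where
  "clone C \<longleftrightarrow> C \<subseteq> boolfuns \<and> (\<forall>n i. i < n \<longrightarrow> proj n i \<in> C) \<and> set_comp C C \<subseteq> C"

definition clonoid :: "boolfun set \<Rightarrow> boolfun set \<Rightarrow> boolfun set \<Rightarrow> bool" where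
  "clonoid C1 C2 K \<longleftrightarrow> K \<subseteq> boolfuns \<and> set_comp K C1 \<subseteq> K \<and> set_comp C2 K \<subseteq> K"

definition clone_generated :: "boolfun set \<Rightarrow> boolfun set" where
  "clone_generated F = \<Inter> {C. clone C \<and> F \<subseteq> C}"

text \<open>There are no nullary functions, so the generating constants are taken to be unary.\<close>

definition const_bf :: "bool \<Rightarrow> boolfun" where
  "const_bf c = mk 1 (\<lambda>_. c)"

definition xor_bf :: boolfun where
  "xor_bf = mk 2 (\<lambda>a. a ! 0 \<noteq> a ! 1)"

definition and_bf :: boolfun where
  "and_bf = mk 2 (\<lambda>a. a ! 0 \<and> a ! 1)"

definition or_bf :: boolfun where
  "or_bf = mk 2 (\<lambda>a. a ! 0 \<or> a ! 1)"

definition self_dual :: "boolfun \<Rightarrow> bool" where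
  "self_dual f \<longleftrightarrow> (\<forall>a \<in> tuples (arity f). app f (map Not a) = (\<not> app f a))"

definition L :: "boolfun set" where
  "L = clone_generated {xor_bf, const_bf True}"

definition L0 :: "boolfun set" where
  "L0 = {f \<in> L. app f (replicate (arity f) False) = False}"

definition L1 :: "boolfun set" where
  "L1 = {f \<in> L. app f (replicate (arity f) True) = True}"

definition LS :: "boolfun set" where
  "LS = {f \<in> L. self_dual f}"

definition Lambda :: "boolfun set" where
  "Lambda = clone_generated {and_bf, const_bf False, const_bf True}"

definition V :: "boolfun set" where
  "V = clone_generated {or_bf, const_bf False, const_bf True}"

definition meet :: "nat \<Rightarrow> bool list set \<Rightarrow> bool list" where
  "meet n T = map (\<lambda>i. \<forall>a \<in> T. a ! i) [0..<n]"

definition join :: "nat \<Rightarrow> bool list set \<Rightarrow> bool list" where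
  "join n F = map (\<lambda>i. \<exists>a \<in> F. a ! i) [0..<n]"

definition U_inf :: "boolfun set" where
  "U_inf = {f \<in> boolfuns. \<forall>T \<subseteq> {a \<in> tuples (arity f). app f a}.
     meet (arity f) T \<noteq> replicate (arity f) False}"

definition W_inf :: "boolfun set" where
  "W_inf = {f \<in> boolfuns. \<forall>F \<subseteq> {a \<in> tuples (arity f). \<not> app f a}.
     join (arity f) F \<noteq> replicate (arity f) True}"

lemma mk_in_boolfuns: "n \<ge> 1 \<Longrightarrow> mk n f \<in> boolfuns"
  by (auto simp: mk_def boolfuns_def)

lemma boolfun_eqI:
  assumes "f \<in> boolfuns" "g \<in> boolfuns" "arity f = arity g"
    and "\<And>a. a \<in> tuples (arity f) \<Longrightarrow> app f a = app g a"
  shows "f = g"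
proof (rule prod_eqI)
  have "app f \<in> tuples (arity f) \<rightarrow>\<^sub>E UNIV" "app g \<in> tuples (arity f) \<rightarrow>\<^sub>E UNIV"
    using assms(1-3) by (auto simp: boolfuns_def case_prod_beta)
  then show "app f = app g" using assms(4) by (rule PiE_ext)
qed (fact assms(3))

lemma set_comp_boolfuns:
  assumes "F \<subseteq> boolfuns" "G \<subseteq> boolfuns"
  shows "set_comp F G \<subseteq> boolfuns"
proof
  fix h assume "h \<in> set_comp F G"
  then obtain m f gs where h: "h = compose_bf m f gs" "f \<in> F" "length gs = arity f"
    "set gs \<subseteq> G" "\<forall>g \<in> set gs. arity g = m"
    by (auto simp: set_comp_def)
  from h assms have "length gs \<ge> 1" by (auto simp: boolfuns_def)
  then obtain g where "g \<in> set gs" by (cases gs) auto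
  then have "g \<in> boolfuns" "arity g = m" using h assms by auto
  then have "m \<ge> 1" by (auto simp: boolfuns_def)
  then show "h \<in> boolfuns" using h by (simp add: compose_bf_def mk_in_boolfuns)
qed

lemma clone_boolfuns: "clone boolfuns"
  using set_comp_boolfuns[of boolfuns boolfuns]
  by (auto simp: clone_def proj_def intro!: mk_in_boolfuns)

lemma set_comp_mono: "F \<subseteq> F' \<Longrightarrow> G \<subseteq> G' \<Longrightarrow> set_comp F G \<subseteq> set_comp F' G'"
  unfolding set_comp_def by blast

lemma clone_clone_generated:
  assumes "F \<subseteq> boolfuns"
  shows "clone (clone_generated F)"
  unfolding clone_def
proof (intro conjI allI impI)
  show "clone_generated F \<subseteq> boolfuns"
    using assms clone_boolfuns by (auto simp: clone_generated_def)
  show "proj n i \<in> clone_generated F" if "i < n" for n i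
    using that by (auto simp: clone_generated_def clone_def)
  have "set_comp (clone_generated F) (clone_generated F) \<subseteq> C" if "clone C" "F \<subseteq> C" for C
  proof -
    have "clone_generated F \<subseteq> C" using that by (auto simp: clone_generated_def)
    then have "set_comp (clone_generated F) (clone_generated F) \<subseteq> set_comp C C"
      by (intro set_comp_mono)
    also have "\<dots> \<subseteq> C" using that by (simp add: clone_def)
    finally show ?thesis .
  qed
  then show "set_comp (clone_generated F) (clone_generated F) \<subseteq> clone_generated F"
    unfolding clone_generated_def[of F] by blast
qed

end

theory Submission
  imports Defs
begin

text \<open>
  Call a subset of \<open>{..<n}\<close> a test set if it has one or two elements or is all of \<open>{..<n}\<close>, and let
  \<open>f\<^sub>n\<close> be the indicator of the test sets. Over the two-element field, an affine map from \<open>n\<close>-tuples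
  to \<open>m\<close>-tuples that sends test sets to test sets but not the zero vector to a test set is rigid:
  the images of the unit vectors are distinct small sets at pairwise distance at most 2, hence form a
  star, so the image of the all-ones vector has between \<open>n - 1\<close> and \<open>n + 1\<close> elements, while being a
  test set forces this number to be \<open>m\<close>. With arities pairwise more than 1 apart, every set \<open>I\<close> of
  indices is recovered from the clonoid of all \<open>g\<close> such that, for \<open>k\<close> outside \<open>I\<close>, no substitution of
  functions from \<open>C1\<close> into \<open>g\<close> yields a function that is 1 on the test sets (and, for the semilattice
  clones, 0 at the zero vector). The remaining cases follow by dualising inputs or outputs.
\<close>

subsection \<open>Affine maps and test sets\<close>

definition test_sets :: "nat \<Rightarrow> nat set set" where
  "test_sets n = {X. X \<subseteq> {..<n} \<and> (card X = 1 \<or> card X = 2 \<or> X = {..<n})}"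

section \<open>Families of small sets with small pairwise symmetric differences\<close>

lemma card_index_le_power:
  assumes "finite B" "inj_on y I" "\<And>i. i \<in> I \<Longrightarrow> y i \<subseteq> B"
  shows "card I \<le> 2 ^ card B"
proof -
  have "card I = card (y ` I)" using assms(2) by (simp add: card_image)
  also have "\<dots> \<le> card (Pow B)" using assms by (intro card_mono) auto
  finally show ?thesis using assms(1) by (simp add: card_Pow)
qed

lemma card_sym_diff_Un:
  assumes "finite A" "finite B"
  shows "card A + card B + card (sym_diff A B) = 2 * card (A \<union> B)"
proof -
  have "card A + card B = card (A \<union> B) + card (A \<inter> B)"
    using assms by (rule card_Un_Int)
  moreover have "card (sym_diff A B \<union> (A \<inter> B)) = card (sym_diff A B) + card (A \<inter> B)"
    using assms by (intro card_Un_disjoint) auto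
  moreover have "sym_diff A B \<union> (A \<inter> B) = A \<union> B" by blast
  ultimately show ?thesis by simp
qed

text \<open>Families that are neither made of singletons nor a star live on a bounded ground set:
  once \<open>y i\<close> and \<open>y j\<close> miss different ends of a two-element member
  \<open>{a, b}\<close>, all members lie in \<open>y i \<union> y j\<close>. These at most four
  points allow only 2^4 = 16 distinct sets.\<close>

lemma star_structure:
  fixes y :: "'i \<Rightarrow> 'a set"
  assumes inj: "inj_on y I" and large: "card I > 16"
    and fin: "\<And>i. i \<in> I \<Longrightarrow> finite (y i)"
    and ne: "\<And>i. i \<in> I \<Longrightarrow> y i \<noteq> {}"
    and small: "\<And>i. i \<in> I \<Longrightarrow> card (y i) \<le> 2"
    and close: "\<And>i j. i \<in> I \<Longrightarrow> j \<in> I \<Longrightarrow> i \<noteq> j \<Longrightarrow> card (sym_diff (y i) (y j)) \<le> 2"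
  shows "(\<forall>i\<in>I. card (y i) = 1) \<or> (\<exists>a. \<forall>i\<in>I. a \<in> y i)"
proof (rule ccontr)
  assume neg: "\<not> ?thesis"
  have three: False if "i \<in> I" "j \<in> I" "p \<in> sym_diff (y i) (y j)" "q \<in> sym_diff (y i) (y j)"
    "r \<in> sym_diff (y i) (y j)" "p \<noteq> q" "p \<noteq> r" "q \<noteq> r" for i j p q r
  proof -
    have "i \<noteq> j" using that by auto
    have "card {p, q, r} \<le> card (sym_diff (y i) (y j))"
      using that fin by (intro card_mono) auto
    then show False using close[OF that(1,2) \<open>i \<noteq> j\<close>] that by simp
  qed
  from neg obtain k where k: "k \<in> I" "card (y k) \<noteq> 1" by blast
  have "card (y k) \<noteq> 0" using k ne fin by simp
  then have "card (y k) = 2" using k small[of k] by linarith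
  then obtain a b where ab: "y k = {a, b}" "a \<noteq> b" by (auto simp: card_2_iff)
  have meets: "a \<in> y i \<or> b \<in> y i" if "i \<in> I" for i
  proof (rule ccontr)
    assume "\<not> ?thesis"
    moreover obtain d where "d \<in> y i" using ne[OF \<open>i \<in> I\<close>] by blast
    ultimately show False using three[OF that k(1), of a b d] ab by auto
  qed
  from neg obtain i where i: "i \<in> I" "a \<notin> y i" by blast
  from neg obtain j where j: "j \<in> I" "b \<notin> y j" by blast
  have bi: "b \<in> y i" and aj: "a \<in> y j" using meets i j by blast+
  \<comment> \<open>A point \<open>d\<close> outside the union would make \<open>y l\<close> equal
    to \<open>{a, d}\<close> or \<open>{b, d}\<close>; then \<open>a\<close>, \<open>b\<close>,
    \<open>d\<close> all lie in its difference from \<open>y i\<close> or from \<open>y j\<close>,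
    respectively.\<close>
  have sub: "y l \<subseteq> y i \<union> y j" if l: "l \<in> I" for l
  proof
    fix d assume d: "d \<in> y l"
    have two: "u = v \<or> u = w \<or> v = w" if "u \<in> y l" "v \<in> y l" "w \<in> y l" for u v w
    proof (rule ccontr)
      assume "\<not> ?thesis"
      then have "card {u, v, w} = 3" by simp
      moreover have "card {u, v, w} \<le> card (y l)" using that l fin by (intro card_mono) auto
      ultimately show False using small[OF l] by simp
    qed
    show "d \<in> y i \<union> y j"
    proof (rule ccontr)
      assume nd: "d \<notin> y i \<union> y j"
      have dab: "d \<noteq> a" "d \<noteq> b" using nd bi aj by auto
      from meets[OF l] show False
      proof
        assume "a \<in> y l"
        then have "b \<notin> y l" using two[of a b d] d dab ab by auto
        then show False using three[OF l i(1), of a b d] \<open>a \<in> y l\<close> d nd dab ab i bi by auto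
      next
        assume "b \<in> y l"
        then have "a \<notin> y l" using two[of a b d] d dab ab by auto
        then show False using three[OF l j(1), of a b d] \<open>b \<in> y l\<close> d nd dab ab j aj by auto
      qed
    qed
  qed
  have "card I \<le> 2 ^ card (y i \<union> y j)"
    using inj sub fin i j by (intro card_index_le_power) auto
  also have "\<dots> \<le> 2 ^ 4"
    using card_Un_le[of "y i" "y j"] small[of i] small[of j] i j by (intro power_increasing) auto
  finally show False using large by simp
qed

text \<open>Counting inside and outside \<open>c\<close> gives
  \<open>card c + 2 * card U \<le> 6\<close> for the union \<open>U\<close> of
  \<open>y i - c\<close> and \<open>y j - c\<close>, so two members together have at most one point
  off \<open>c\<close>. Hence all members share a ground set of at most seven points, and 2^7 =
  128.\<close>

lemma no_pairwise_close_to_large: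
  fixes y :: "'i \<Rightarrow> 'a set"
  assumes inj: "inj_on y I" and large: "card I > 128"
    and c: "finite c" "3 \<le> card c" "card c \<le> 6"
    and fin: "\<And>i. i \<in> I \<Longrightarrow> finite (y i)"
    and small: "\<And>i. i \<in> I \<Longrightarrow> card (y i) \<le> 2"
    and close: "\<And>i j. i \<in> I \<Longrightarrow> j \<in> I \<Longrightarrow> i \<noteq> j \<Longrightarrow>
      card (sym_diff (sym_diff (y i) (y j)) c) \<le> 2"
  shows False
proof -
  have outside: "card ((y i - c) \<union> (y j - c)) \<le> 1" if ij: "i \<in> I" "j \<in> I" "i \<noteq> j" for i j
  proof -
    define D where "D = sym_diff (sym_diff (y i) (y j)) c"
    have f: "finite (y i)" "finite (y j)" "finite D" using fin ij c by (auto simp: D_def)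
    have split: "card A = card (A \<inter> c) + card (A - c)" if "finite A" for A
      using card_Un_disjoint[of "A \<inter> c" "A - c"] that by (simp add: Int_Diff_disjoint Int_Diff_Un)
    have "card c \<le> card ((D \<inter> c) \<union> ((y i \<inter> c) \<union> (y j \<inter> c)))"
      using f by (intro card_mono) (auto simp: D_def)
    also have "\<dots> \<le> card (D \<inter> c) + (card (y i \<inter> c) + card (y j \<inter> c))"
      using card_Un_le[of "D \<inter> c" "(y i \<inter> c) \<union> (y j \<inter> c)"] card_Un_le[of "y i \<inter> c" "y j \<inter> c"] by linarith
    finally have "card c \<le> card (D \<inter> c) + (card (y i \<inter> c) + card (y j \<inter> c))" .
    moreover have "sym_diff (y i - c) (y j - c) = D - c" by (auto simp: D_def)
    then have "card (y i - c) + card (y j - c) + card (D - c) = 2 * card ((y i - c) \<union> (y j - c))"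
      using card_sym_diff_Un[of "y i - c" "y j - c"] f by simp
    moreover have "card D \<le> 2" using close[OF ij] by (simp add: D_def)
    ultimately show ?thesis
      using split[OF f(1)] split[OF f(2)] split[OF f(3)] small[OF ij(1)] small[OF ij(2)] c
      by linarith
  qed
  have "\<exists>B. finite B \<and> card B \<le> 7 \<and> (\<forall>i\<in>I. y i \<subseteq> B)"
  proof (cases "\<forall>i\<in>I. y i \<subseteq> c")
    case True
    then show ?thesis using c by (intro exI[of _ c]) auto
  next
    case False
    then obtain k p where k: "k \<in> I" "p \<in> y k" "p \<notin> c" by blast
    have "y i \<subseteq> insert p c" if i: "i \<in> I" for i
    proof -
      \<comment> \<open>Since \<open>outside\<close> compares two different indices, the case
        \<open>i = k\<close> has to borrow a partner.\<close>
      obtain j where j: "j \<in> I" "j \<noteq> k" "i = k \<or> i = j"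
      proof (cases "i = k")
        case True
        have "\<not> I \<subseteq> {k}" using large card_mono[of "{k}" I] by auto
        then show ?thesis using that True by blast
      qed (use i that in blast)
      have fU: "finite ((y k - c) \<union> (y j - c))" using fin k j by auto
      have "p \<in> (y k - c) \<union> (y j - c)" using k by blast
      then have "q = p" if "q \<in> (y k - c) \<union> (y j - c)" for q
        using that outside[of k j] j(1,2) k(1) fU by (metis card_le_Suc0_iff_eq One_nat_def)
      then show ?thesis using j by blast
    qed
    then show ?thesis using c by (intro exI[of _ "insert p c"]) (auto simp: card_insert_if)
  qed
  then obtain B where B: "finite B" "card B \<le> 7" "\<And>i. i \<in> I \<Longrightarrow> y i \<subseteq> B" by blast
  have "card I \<le> 2 ^ card B" using B inj by (intro card_index_le_power) auto
  also have "\<dots> \<le> 2 ^ 7" using B by (intro power_increasing) auto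
  finally show False using large by simp
qed

section \<open>Affine maps over the two-element field, written as maps of sets\<close>

lemma affine_set_map_parity:
  fixes \<Phi> :: "nat set \<Rightarrow> 'a set"
  assumes aff: "\<And>X Y Z. X \<subseteq> {..<n} \<Longrightarrow> Y \<subseteq> {..<n} \<Longrightarrow> Z \<subseteq> {..<n} \<Longrightarrow>
      \<Phi> (sym_diff (sym_diff X Y) Z) = sym_diff (sym_diff (\<Phi> X) (\<Phi> Y)) (\<Phi> Z)"
    and zero: "\<Phi> {} = {}" and X: "X \<subseteq> {..<n}"
  shows "p \<in> \<Phi> X \<longleftrightarrow> odd (card {i\<in>X. p \<in> \<Phi> {i}})"
proof -
  have "finite X" using X finite_subset by blast
  then show ?thesis using X
  proof (induction X)
    case empty
    then show ?case using zero by simp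
  next
    case (insert x X)
    have "sym_diff (sym_diff X {x}) {} = insert x X" using insert by auto
    then have "\<Phi> (insert x X) = sym_diff (\<Phi> X) (\<Phi> {x})"
      using aff[of X "{x}" "{}"] insert zero by auto
    moreover have "{i \<in> insert x X. p \<in> \<Phi> {i}} =
        (if p \<in> \<Phi> {x} then insert x {i\<in>X. p \<in> \<Phi> {i}} else {i\<in>X. p \<in> \<Phi> {i}})"
      by auto
    ultimately show ?case using insert by auto
  qed
qed

text \<open>The translation part \<open>c = \<Phi> {}\<close> must vanish, because a nonempty
  \<open>c\<close> that is not a test set has at least three points and shifts too many pairs off
  the test sets. The map is then linear, and the star formed by the images of the singletons
  determines the image of the full set up to one point.\<close>

lemma affine_test_sets_rigid:
  fixes \<Phi> :: "nat set \<Rightarrow> nat set"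
  assumes aff: "\<And>X Y Z. X \<subseteq> {..<n} \<Longrightarrow> Y \<subseteq> {..<n} \<Longrightarrow> Z \<subseteq> {..<n} \<Longrightarrow>
      \<Phi> (sym_diff (sym_diff X Y) Z) = sym_diff (sym_diff (\<Phi> X) (\<Phi> Y)) (\<Phi> Z)"
    and test: "\<And>X. X \<in> test_sets n \<Longrightarrow> \<Phi> X \<in> test_sets m"
    and empty: "\<Phi> {} \<notin> test_sets m" "\<Phi> {} \<subseteq> {..<m}"
    and large: "200 \<le> n" "200 \<le> m"
  shows "n \<le> Suc m \<and> m \<le> Suc n"
proof -
  define c where "c = \<Phi> {}"
  define y where "y i = \<Phi> {i}" for i
  have y: "y i \<in> test_sets m" if "i < n" for i
    using test[of "{i}"] that by (simp add: y_def test_sets_def)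
  have y_sub: "y i \<subseteq> {..<m}" if "i < n" for i using y that by (auto simp: test_sets_def)
  have y_fin: "finite (y i)" if "i < n" for i using y_sub that finite_subset by blast
  have c_sub: "c \<subseteq> {..<m}" and c_fin: "finite c" and c_test: "c \<notin> test_sets m"
    using empty finite_subset by (auto simp: c_def)
  have pair: "sym_diff (sym_diff (y i) (y j)) c \<in> test_sets m" if "i < n" "j < n" "i \<noteq> j" for i j
  proof -
    have "\<Phi> {i, j} \<in> test_sets m" using test[of "{i, j}"] that by (simp add: test_sets_def)
    moreover have "sym_diff (sym_diff {i} {j}) {} = {i, j}" using that by auto
    ultimately show ?thesis
      using aff[of "{i}" "{j}" "{}"] that by (simp add: y_def c_def)
  qed
  \<comment> \<open>Equal images of two singletons would send \<open>{i, j}\<close> to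
    \<open>c\<close>, which is not a test set.\<close>
  have inj: "inj_on y {..<n}"
  proof (rule inj_onI, rule ccontr)
    fix i j assume ij: "i \<in> {..<n}" "j \<in> {..<n}" "y i = y j" "i \<noteq> j"
    then have "sym_diff (sym_diff (y i) (y j)) c = c" by auto
    then show False using pair[of i j] ij c_test by auto
  qed
  show ?thesis
  proof (cases "c = {}")
    case False
    define I where "I = {i. i < n \<and> card (y i) \<le> 2}"
    have "{..<n} - I \<subseteq> {i. i < n \<and> y i = {..<m}}"
      using y by (force simp: I_def test_sets_def)
    moreover have "card {i. i < n \<and> y i = {..<m}} \<le> 1"
      using inj by (auto simp: card_le_Suc0_iff_eq inj_on_def)
    ultimately have "card ({..<n} - I) \<le> 1"
      using card_mono[of "{i. i < n \<and> y i = {..<m}}" "{..<n} - I"] by simp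
    moreover have "card ({..<n} - I) = n - card I" 
      by (subst card_Diff_subset) (auto simp: I_def)
    ultimately have I: "card I > 128" using large by linarith
    have inj_I: "inj_on y I" using inj by (rule inj_on_subset) (auto simp: I_def)
    have c3: "card c \<ge> 3"
    proof -
      have "card c \<noteq> 0" using False c_fin by simp
      moreover have "card c \<noteq> 1" "card c \<noteq> 2" using c_test c_sub by (auto simp: test_sets_def)
      ultimately show ?thesis by linarith
    qed
    \<comment> \<open>If \<open>c\<close> has at most six points, \<open>?D\<close> has at most ten
      and cannot be full, so it is small. If \<open>c\<close> is larger, at least three points
      survive two small sets, so every \<open>?D\<close> is full, and cancellation contradicts
      injectivity.\<close>
    have "False"
    proof (cases "card c \<le> 6")
      case True
      show False
      proof (rule no_pairwise_close_to_large[OF inj_I I c_fin c3 True])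
        fix i j assume ij: "i \<in> I" "j \<in> I" "i \<noteq> j"
        let ?D = "sym_diff (sym_diff (y i) (y j)) c"
        have "card ?D \<le> card (y i \<union> (y j \<union> c))"
          using ij y_fin c_fin by (intro card_mono) (auto simp: I_def)
        also have "\<dots> \<le> card (y i) + (card (y j) + card c)"
          using card_Un_le[of "y i" "(y j) \<union> (c)"] card_Un_le[of "y j" "c"] by linarith
        also have "\<dots> < m" using ij True large by (auto simp: I_def)
        finally show "card ?D \<le> 2" using pair[of i j] ij by (auto simp: I_def test_sets_def)
      qed (use y_fin in \<open>auto simp: I_def\<close>)
    next
      case False
      have full: "sym_diff (sym_diff (y i) (y j)) c = {..<m}" if ij: "i \<in> I" "j \<in> I" "i \<noteq> j" for i j
      proof -
        let ?D = "sym_diff (sym_diff (y i) (y j)) c"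
        have "card c \<le> card (y i \<union> (y j \<union> ?D))"
          using ij y_fin c_fin by (intro card_mono) (auto simp: I_def)
        also have "\<dots> \<le> card (y i) + (card (y j) + card ?D)"
          using card_Un_le[of "y i" "(y j) \<union> (?D)"] card_Un_le[of "y j" "?D"] by linarith
        finally have "card ?D > 2" using ij False by (auto simp: I_def)
        then show ?thesis using pair[of i j] ij by (auto simp: I_def test_sets_def)
      qed
      obtain J where "J \<subseteq> I" "card J = 3"
        using obtain_subset_with_card_n[of 3 I] I by auto
      then obtain i j k where ijk: "i \<in> I" "j \<in> I" "k \<in> I" "i \<noteq> j" "i \<noteq> k" "j \<noteq> k"
        by (auto simp: card_3_iff)
      have "sym_diff (sym_diff (y i) (y j)) c = sym_diff (sym_diff (y i) (y k)) c"
        using full[of i j] full[of i k] ijk by simp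
      then have "y j = y k" by blast
      then show False using inj_I ijk by (auto dest: inj_onD)
    qed
    then show ?thesis ..
  next
    case True
    have pair0: "sym_diff (y i) (y j) \<in> test_sets m" if "i < n" "j < n" "i \<noteq> j" for i j
      using pair[OF that] True by simp
    \<comment> \<open>A full \<open>y i\<close> would differ from another \<open>y j\<close> by a
      set of \<open>m - 1\<close> or \<open>m - 2\<close> points, which is no size of a test
      set.\<close>
    have small: "card (y i) \<le> 2" if i: "i < n" for i
    proof (rule ccontr)
      assume "\<not> ?thesis"
      then have yi: "y i = {..<m}" using y[OF i] by (auto simp: test_sets_def)
      obtain j where j: "j < n" "j \<noteq> i"
        using that[of 0] that[of 1] large by (cases "i = 0") auto
      have "y j \<noteq> {..<m}" using inj i j yi by (auto dest: inj_onD)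
      then have cj: "card (y j) = 1 \<or> card (y j) = 2" using y[OF j(1)] by (auto simp: test_sets_def)
      have "sym_diff (y i) (y j) = {..<m} - y j" using yi y_sub[OF j(1)] by auto
      moreover have "card ({..<m} - y j) = m - card (y j)"
        using y_sub[OF j(1)] y_fin[OF j(1)] by (simp add: card_Diff_subset)
      moreover have "card Z = 1 \<or> card Z = 2 \<or> card Z = m" if "Z \<in> test_sets m" for Z
        using that by (auto simp: test_sets_def)
      ultimately have "m - card (y j) = 1 \<or> m - card (y j) = 2 \<or> m - card (y j) = m"
        using pair0[OF i j(1)] j by metis
      then show False using cj large by linarith
    qed
    have ne: "y i \<noteq> {}" if "i < n" for i using y[OF that] large by (auto simp: test_sets_def lessThan_empty_iff)
    have close: "card (sym_diff (y i) (y j)) \<le> 2" if "i < n" "j < n" "i \<noteq> j" for i j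
    proof -
      have "card (sym_diff (y i) (y j)) \<le> card (y i \<union> y j)"
        using that y_fin by (intro card_mono) auto
      also have "\<dots> \<le> 4" using card_Un_le[of "y i" "y j"] small[of i] small[of j] that by linarith
      finally show ?thesis using pair0[OF that] large by (auto simp: test_sets_def)
    qed
    have star: "(\<forall>i\<in>{..<n}. card (y i) = 1) \<or> (\<exists>a. \<forall>i\<in>{..<n}. a \<in> y i)"
      using inj large y_fin ne small close by (intro star_structure) auto
    \<comment> \<open>Here \<open>a\<close> is the centre of the star. For singletons it is set to
      \<open>m\<close>, a point outside \<open>{..<m}\<close>, so that deleting it changes
      nothing.\<close>
    obtain a where a1: "\<And>i. i < n \<Longrightarrow> card (y i - {a}) \<le> 1"
      and a_inj: "inj_on (\<lambda>i. y i - {a}) {..<n}"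
    proof (cases "\<forall>i<n. card (y i) = 1")
      case True
      have eq: "y i - {m} = y i" if "i < n" for i using y_sub[OF that] by auto
      have "inj_on (\<lambda>i. y i - {m}) {..<n} = inj_on y {..<n}"
        using eq by (intro inj_on_cong) auto
      then show ?thesis using that[of m] eq True inj by auto
    next
      case False
      then obtain a where a: "\<And>i. i < n \<Longrightarrow> a \<in> y i" using star by auto
      have "inj_on (\<lambda>i. y i - {a}) {..<n}"
        using inj a by (intro inj_onI) (metis inj_onD insert_Diff lessThan_iff)
      moreover have "card (y i - {a}) \<le> 1" if "i < n" for i
        using small[OF that] a[OF that] y_fin[OF that] by simp
      ultimately show ?thesis using that by blast
    qed
    define T where "T = \<Phi> {..<n}"
    define X where "X = (\<Union>i<n. y i - {a})"
    have X_fin: "finite X" using y_fin by (auto simp: X_def)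
    have sing: "y i - {a} = {p}" if "i < n" "p \<in> y i" "p \<noteq> a" for i p
    proof -
      have "card (y i - {a}) \<noteq> 0" using y_fin that by auto
      then have "card (y i - {a}) = 1" using a1[OF that(1)] by linarith
      then obtain q where q: "y i - {a} = {q}" by (auto simp: card_1_singleton_iff)
      have "p \<in> y i - {a}" using that by simp
      then have "p = q" unfolding q by simp
      then show ?thesis using q by simp
    qed
    \<comment> \<open>Off the centre each point lies in at most one \<open>y i\<close>, so the sum
      modulo 2 is simply the union.\<close>
    have T_X: "T - {a} = X"
    proof (rule set_eqI)
      fix p
      show "p \<in> T - {a} \<longleftrightarrow> p \<in> X"
      proof (cases "p = a")
        case False
        let ?J = "{i \<in> {..<n}. p \<in> y i}"
        have "i = j" if "i \<in> ?J" "j \<in> ?J" for i j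
          using that sing[of i p] sing[of j p] False by (intro inj_onD[OF a_inj]) auto
        then have "card ?J \<le> Suc 0" by (subst card_le_Suc0_iff_eq) auto
        then have "card ?J = 0 \<or> card ?J = 1" by linarith
        then have "odd (card ?J) \<longleftrightarrow> card ?J \<noteq> 0" by (metis odd_one even_zero zero_neq_one)
        moreover have "card ?J \<noteq> 0 \<longleftrightarrow> ?J \<noteq> {}" by simp
        ultimately have "odd (card ?J) \<longleftrightarrow> ?J \<noteq> {}" by (rule trans)
        moreover have "p \<in> T \<longleftrightarrow> odd (card ?J)"
          using affine_set_map_parity[of n \<Phi> "{..<n}" p, OF aff] True
          unfolding T_def y_def c_def by blast
        ultimately show ?thesis using False by (auto simp: X_def)
      qed (auto simp: X_def)
    qed
    \<comment> \<open>At most one index has \<open>y i - {a}\<close> empty, which accounts for the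
      \<open>Suc\<close>.\<close>
    have "n = card ((\<lambda>i. y i - {a}) ` {..<n})" using a_inj by (simp add: card_image)
    also have "\<dots> \<le> card (insert {} ((\<lambda>p. {p}) ` X))"
    proof (intro card_mono subsetI)
      fix Z assume "Z \<in> (\<lambda>i. y i - {a}) ` {..<n}"
      then obtain i where i: "i < n" "Z = y i - {a}" by auto
      show "Z \<in> insert {} ((\<lambda>p. {p}) ` X)"
      proof (cases "Z = {}")
        case False
        then obtain p where "p \<in> y i" "p \<noteq> a" using i by blast
        then show ?thesis using sing[of i p] i by (auto simp: X_def)
      qed simp
    qed (use X_fin in auto)
    also have "\<dots> \<le> Suc (card X)"
      using X_fin card_image_le[of X "\<lambda>p. {p}"] by (simp add: card_insert_if)
    finally have n_le: "n \<le> Suc (card X)" .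
    have "card X = card ((\<lambda>p. {p}) ` X)" by (simp add: card_image)
    also have "\<dots> \<le> card ((\<lambda>i. y i - {a}) ` {..<n})"
    proof (intro card_mono subsetI)
      fix Z assume "Z \<in> (\<lambda>p. {p}) ` X"
      then obtain i p where "i < n" "p \<in> y i" "p \<noteq> a" "Z = {p}" by (auto simp: X_def)
      then show "Z \<in> (\<lambda>i. y i - {a}) ` {..<n}" using sing[of i p] by auto
    qed simp
    also have "\<dots> \<le> n" using card_image_le[of "{..<n}"] by simp
    finally have X_le: "card X \<le> n" .
    have T: "T \<in> test_sets m" using test[of "{..<n}"] by (simp add: T_def test_sets_def)
    then have T_fin: "finite T" using finite_subset by (auto simp: test_sets_def)
    have "card X \<le> card T" using T_X T_fin card_mono[of T X] by blast
    moreover have "card T \<le> Suc (card X)"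
      unfolding T_X[symmetric] card_Diff_singleton_if by (cases "a \<in> T") auto
    \<comment> \<open>\<open>T\<close> has at least \<open>n - 1\<close> points, hence more than
      two, so as a test set it can only be full.\<close>
    ultimately have "card T = m" using T n_le large by (auto simp: test_sets_def)
    then show ?thesis using \<open>card X \<le> card T\<close> \<open>card T \<le> Suc (card X)\<close> n_le X_le by linarith
  qed
qed

subsection \<open>Uncountable families of clonoids\<close>

lemma app_compose_bf:
  "length a = m \<Longrightarrow> app (compose_bf m f gs) a = app f (map (\<lambda>g. app g a) gs)"
  by (simp add: compose_bf_def mk_def tuples_def)

lemma compose_bf_assoc:
  assumes "length hs = k"
  shows "compose_bf m (compose_bf k f gs) hs = compose_bf m f (map (\<lambda>g. compose_bf m g hs) gs)"
proof -
  have "app (compose_bf k f gs) (map (\<lambda>h. app h a) hs) =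
      app f (map (\<lambda>g. app g a) (map (\<lambda>g. compose_bf m g hs) gs))" if "length a = m" for a
    using assms that by (simp add: app_compose_bf comp_def)
  then show ?thesis
    unfolding compose_bf_def[of m "compose_bf k f gs"] compose_bf_def[of m f] mk_def
    by (auto simp: tuples_def intro!: restrict_ext)
qed

lemma compose_bf_proj:
  assumes "f \<in> boolfuns"
  shows "compose_bf (arity f) f (map (proj (arity f)) [0..<arity f]) = f"
proof (rule boolfun_eqI)
  have n: "arity f \<ge> 1" using assms by (auto simp: boolfuns_def)
  then show "compose_bf (arity f) f (map (proj (arity f)) [0..<arity f]) \<in> boolfuns"
    by (simp add: compose_bf_def mk_in_boolfuns)
  fix a assume "a \<in> tuples (arity (compose_bf (arity f) f (map (proj (arity f)) [0..<arity f])))"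
  then have a: "length a = arity f" by (simp add: compose_bf_def mk_def tuples_def)
  then have "map (\<lambda>g. app g a) (map (proj (arity f)) [0..<arity f]) = a"
    by (intro nth_equalityI) (auto simp: proj_def mk_def tuples_def)
  then show "app (compose_bf (arity f) f (map (proj (arity f)) [0..<arity f])) a = app f a"
    using a by (simp add: compose_bf_def mk_def tuples_def)
qed (use assms in \<open>auto simp: compose_bf_def mk_def\<close>)

lemma arity_compose_bf [simp]: "arity (compose_bf m f gs) = m"
  by (simp add: compose_bf_def mk_def)

lemma arity_mk [simp]: "arity (mk n f) = n"
  by (simp add: mk_def)

lemma app_mk: "length a = n \<Longrightarrow> app (mk n f) a = f a"
  by (simp add: mk_def tuples_def)

lemma uncountable_UNIV_nat_set: "uncountable (UNIV :: nat set set)"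
proof
  assume "countable (UNIV :: nat set set)"
  then obtain f :: "nat \<Rightarrow> nat set" where "range f = UNIV"
    using uncountable_def[of "UNIV :: nat set set"] by auto
  then show False using Cantors_theorem[of "UNIV :: nat set"] by auto
qed

text \<open>Each \<open>Q k\<close> is a property preserved by \<open>C2\<close> that
  \<open>F k\<close> violates, while every other \<open>F j\<close> has it after any substitution
  from \<open>C1\<close>. A set \<open>I\<close> of indices can therefore be read off from a clonoid
  that contains \<open>F k\<close> exactly for \<open>k \<in> I\<close>.\<close>

lemma uncountable_clonoids:
  fixes F :: "nat \<Rightarrow> boolfun" and Q :: "nat \<Rightarrow> boolfun set"
  assumes C1: "clone C1" and C2: "C2 \<subseteq> boolfuns"
    and F: "\<And>k. F k \<in> boolfuns"
    and F_notin: "\<And>k. F k \<notin> Q k"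
    and F_in: "\<And>j k gs. j \<noteq> k \<Longrightarrow> length gs = arity (F j) \<Longrightarrow> set gs \<subseteq> C1 \<Longrightarrow>
      (\<And>g. g \<in> set gs \<Longrightarrow> arity g = arity (F k)) \<Longrightarrow> compose_bf (arity (F k)) (F j) gs \<in> Q k"
    and Q_closed: "\<And>k u hs. u \<in> C2 \<Longrightarrow> length hs = arity u \<Longrightarrow> set hs \<subseteq> Q k \<Longrightarrow>
      compose_bf (arity (F k)) u hs \<in> Q k"
  shows "uncountable {K. clonoid C1 C2 K}"
proof -
  \<comment> \<open>Quantifying over all substitutions from \<open>C1\<close> gives closure under
    inner composition by associativity; outer closure comes from \<open>Q_closed\<close>.\<close>
  define K where "K I = {g \<in> boolfuns. \<forall>k. k \<notin> I \<longrightarrow> (\<forall>gs. length gs = arity g \<longrightarrow> set gs \<subseteq> C1 \<longrightarrow>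
    (\<forall>h\<in>set gs. arity h = arity (F k)) \<longrightarrow> compose_bf (arity (F k)) g gs \<in> Q k)}" for I
  have C1_sub: "C1 \<subseteq> boolfuns" and C1_comp: "set_comp C1 C1 \<subseteq> C1"
    using C1 by (auto simp: clone_def)
  have "clonoid C1 C2 (K I)" for I
  proof -
    have sub: "K I \<subseteq> boolfuns" by (auto simp: K_def)
    have "h \<in> K I" if h: "h \<in> set_comp (K I) C1" for h
    proof -
      have "h \<in> boolfuns" using h set_comp_boolfuns[OF sub C1_sub] by blast
      obtain m f fs where f: "h = compose_bf m f fs" "f \<in> K I" "length fs = arity f"
        "set fs \<subseteq> C1" "\<forall>g\<in>set fs. arity g = m"
        using h by (auto simp: set_comp_def)
      have "compose_bf (arity (F k)) h gs \<in> Q k" if k: "k \<notin> I" and gs: "length gs = arity h"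
        "set gs \<subseteq> C1" "\<forall>g\<in>set gs. arity g = arity (F k)" for k gs
      proof -
        have "compose_bf (arity (F k)) g gs \<in> C1" if "g \<in> set fs" for g
        proof -
          have "compose_bf (arity (F k)) g gs \<in> set_comp C1 C1"
            unfolding set_comp_def using that f gs by fastforce
          then show ?thesis using C1_comp by blast
        qed
        then have "set (map (\<lambda>g. compose_bf (arity (F k)) g gs) fs) \<subseteq> C1"
          unfolding set_map by blast
        then have "compose_bf (arity (F k)) f (map (\<lambda>g. compose_bf (arity (F k)) g gs) fs) \<in> Q k"
          using f k by (simp add: K_def)
        then show ?thesis using f gs by (simp add: compose_bf_assoc)
      qed
      then show ?thesis using \<open>h \<in> boolfuns\<close> by (auto simp: K_def)
    qed
    moreover have "h \<in> K I" if h: "h \<in> set_comp C2 (K I)" for h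
    proof -
      have "h \<in> boolfuns" using h set_comp_boolfuns[OF C2 sub] by blast
      obtain m u fs where u: "h = compose_bf m u fs" "u \<in> C2" "length fs = arity u"
        "set fs \<subseteq> K I" "\<forall>g\<in>set fs. arity g = m"
        using h by (auto simp: set_comp_def)
      have "compose_bf (arity (F k)) h gs \<in> Q k" if k: "k \<notin> I" and gs: "length gs = arity h"
        "set gs \<subseteq> C1" "\<forall>g\<in>set gs. arity g = arity (F k)" for k gs
      proof -
        have "compose_bf (arity (F k)) g gs \<in> Q k" if "g \<in> set fs" for g
          using that u gs k by (auto simp: K_def)
        then have "compose_bf (arity (F k)) u (map (\<lambda>g. compose_bf (arity (F k)) g gs) fs) \<in> Q k"
          using u by (intro Q_closed) auto
        then show ?thesis using u gs by (simp add: compose_bf_assoc)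
      qed
      then show ?thesis using \<open>h \<in> boolfuns\<close> by (auto simp: K_def)
    qed
    ultimately show ?thesis using sub by (auto simp: clonoid_def)
  qed
  then have range: "range K \<subseteq> {K. clonoid C1 C2 K}" by blast
  have F_K: "F k \<in> K I \<longleftrightarrow> k \<in> I" for k I
  proof
    assume "k \<in> I"
    have "compose_bf (arity (F j)) (F k) gs \<in> Q j"
      if "j \<notin> I" "length gs = arity (F k)" "set gs \<subseteq> C1" "\<forall>h\<in>set gs. arity h = arity (F j)" for j gs
      using that \<open>k \<in> I\<close> by (intro F_in) auto
    then show "F k \<in> K I" using F by (simp add: K_def)
  next
    assume in_K: "F k \<in> K I"
    show "k \<in> I"
    proof (rule ccontr)
      assume "k \<notin> I"
      \<comment> \<open>Substituting the projections is the identity, so membership would put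
        \<open>F k\<close> itself into \<open>Q k\<close>.\<close>
      let ?ps = "map (proj (arity (F k))) [0..<arity (F k)]"
      have "set ?ps \<subseteq> C1" using C1 by (auto simp: clone_def)
      moreover have "\<forall>h\<in>set ?ps. arity h = arity (F k)" by (auto simp: proj_def)
      moreover have "length ?ps = arity (F k)" by simp
      ultimately have "compose_bf (arity (F k)) (F k) ?ps \<in> Q k"
        using in_K \<open>k \<notin> I\<close> unfolding K_def by blast
      then show False using compose_bf_proj[OF F] F_notin by simp
    qed
  qed
  have "inj K"
  proof (rule injI, rule set_eqI)
    fix I J and k :: nat assume "K I = K J"
    then show "k \<in> I \<longleftrightarrow> k \<in> J" using F_K[of k I] F_K[of k J] by simp
  qed
  then have "uncountable (range K)"
    using uncountable_UNIV_nat_set countable_image_inj_on[of K UNIV] by blast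
  then show ?thesis using range countable_subset by blast
qed

subsection \<open>Linear, semilattice and separating functions\<close>

definition xor3 :: "bool list \<Rightarrow> bool list \<Rightarrow> bool list \<Rightarrow> bool list" where
  "xor3 a b d = map (\<lambda>i. a ! i \<noteq> (b ! i \<noteq> d ! i)) [0..<length a]"

text \<open>With three summands the constant term occurs an odd number of times on both sides, so
  functions with constant term 1 satisfy the condition as well.\<close>

definition affine_bf :: "boolfun \<Rightarrow> bool" where
  "affine_bf f \<longleftrightarrow> (\<forall>a\<in>tuples (arity f). \<forall>b\<in>tuples (arity f). \<forall>d\<in>tuples (arity f).
     app f (xor3 a b d) = (app f a \<noteq> (app f b \<noteq> app f d)))"

text \<open>
  For \<open>c = True\<close>: if \<open>f\<close> is 1 on a nonempty set \<open>T\<close> whose meet lies below \<open>b\<close>, then \<open>f\<close> is 1 at \<open>b\<close>.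
  For \<open>c = False\<close> this is the dual condition.
\<close>

definition semilattice_bf :: "bool \<Rightarrow> boolfun \<Rightarrow> bool" where
  "semilattice_bf c f \<longleftrightarrow> (\<forall>T b. T \<noteq> {} \<longrightarrow> T \<subseteq> tuples (arity f) \<longrightarrow> b \<in> tuples (arity f) \<longrightarrow>
     (\<forall>i<arity f. (\<forall>a\<in>T. a ! i = c) \<longrightarrow> b ! i = c) \<longrightarrow> (\<forall>a\<in>T. app f a = c) \<longrightarrow> app f b = c)"

lemma semilattice_bfD:
  assumes "semilattice_bf c f" "T \<noteq> {}" "T \<subseteq> tuples (arity f)" "b \<in> tuples (arity f)"
    and "\<And>i. i < arity f \<Longrightarrow> (\<And>a. a \<in> T \<Longrightarrow> a ! i = c) \<Longrightarrow> b ! i = c"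
    and "\<And>a. a \<in> T \<Longrightarrow> app f a = c"
  shows "app f b = c"
  using assms(1)[unfolded semilattice_bf_def, THEN spec, THEN spec, of T b] assms(2-) by simp

lemma clone_generated_subset: "clone C \<Longrightarrow> F \<subseteq> C \<Longrightarrow> clone_generated F \<subseteq> C"
  by (auto simp: clone_generated_def)

lemma cloneI:
  assumes "\<And>n i. i < n \<Longrightarrow> P (proj n i)"
    and "\<And>m f gs. P f \<Longrightarrow> length gs = arity f \<Longrightarrow> (\<And>g. g \<in> set gs \<Longrightarrow> P g \<and> arity g = m) \<Longrightarrow>
      P (compose_bf m f gs)"
  shows "clone {f \<in> boolfuns. P f}"
  unfolding clone_def
proof (intro conjI allI impI subsetI)
  fix h assume h: "h \<in> set_comp {f \<in> boolfuns. P f} {f \<in> boolfuns. P f}"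
  then have "h \<in> boolfuns" using set_comp_boolfuns[of "{f \<in> boolfuns. P f}" "{f \<in> boolfuns. P f}"] by auto
  moreover have "P h" using h assms(2) by (force simp: set_comp_def)
  ultimately show "h \<in> {f \<in> boolfuns. P f}" by simp
qed (use assms(1) in \<open>auto simp: proj_def intro!: mk_in_boolfuns\<close>)

lemma clone_affine_bf: "clone {f \<in> boolfuns. affine_bf f}"
proof (rule cloneI)
  show "affine_bf (proj n i)" if "i < n" for n i
    using that by (auto simp: affine_bf_def proj_def app_mk tuples_def xor3_def)
  fix m f gs assume f: "affine_bf f" "length gs = arity f"
    and gs: "\<And>g. g \<in> set gs \<Longrightarrow> affine_bf g \<and> arity g = m"
  have "app (compose_bf m f gs) (xor3 a b d) =
      (app (compose_bf m f gs) a \<noteq> (app (compose_bf m f gs) b \<noteq> app (compose_bf m f gs) d))"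
    if abd: "length a = m" "length b = m" "length d = m" for a b d
  proof -
    let ?v = "\<lambda>a. map (\<lambda>g. app g a) gs"
    have "?v (xor3 a b d) = xor3 (?v a) (?v b) (?v d)"
      using gs abd by (intro nth_equalityI) (auto simp: xor3_def[of "?v a"] affine_bf_def tuples_def)
    moreover have "length (xor3 a b d) = m" using abd by (simp add: xor3_def)
    ultimately show ?thesis
      using f abd by (simp add: app_compose_bf affine_bf_def tuples_def)
  qed
  then show "affine_bf (compose_bf m f gs)"
    by (simp add: affine_bf_def tuples_def)
qed

text \<open>The condition for the inner function \<open>gs ! i\<close> is exactly the hypothesis at
  coordinate \<open>i\<close> under which the outer condition applies to the tuples
  \<open>?v a\<close>.\<close>

lemma clone_semilattice_bf: "clone {f \<in> boolfuns. semilattice_bf c f}"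
proof (rule cloneI)
  show "semilattice_bf c (proj n i)" if "i < n" for n i
    using that unfolding semilattice_bf_def proj_def by (auto simp: app_mk tuples_def subset_iff)
  fix m f gs assume f: "semilattice_bf c f" "length gs = arity f"
    and gs: "\<And>g. g \<in> set gs \<Longrightarrow> semilattice_bf c g \<and> arity g = m"
  let ?v = "\<lambda>a. map (\<lambda>g. app g a) gs"
  show "semilattice_bf c (compose_bf m f gs)"
    unfolding semilattice_bf_def arity_compose_bf
  proof (intro allI impI)
    fix T b assume T: "T \<noteq> {}" "T \<subseteq> tuples m" "b \<in> tuples m"
      "\<forall>i<m. (\<forall>a\<in>T. a ! i = c) \<longrightarrow> b ! i = c" "\<forall>a\<in>T. app (compose_bf m f gs) a = c"
    have "app f (?v b) = c"
    proof (rule semilattice_bfD[OF f(1)])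
      show "?v ` T \<noteq> {}" "?v ` T \<subseteq> tuples (arity f)" "?v b \<in> tuples (arity f)"
        using T(1) f(2) by (auto simp: tuples_def)
      show "app f a = c" if "a \<in> ?v ` T" for a
        using that T(2,5) by (auto simp: app_compose_bf tuples_def subset_iff)
      fix i assume i: "i < arity f" and all: "\<And>a. a \<in> ?v ` T \<Longrightarrow> a ! i = c"
      have "app (gs ! i) a = c" if "a \<in> T" for a using all[OF imageI[OF that]] i f(2) by simp
      moreover have "gs ! i \<in> set gs" using i f(2) by simp
      ultimately have "app (gs ! i) b = c"
        using gs[of "gs ! i"] T(1-4) by (intro semilattice_bfD[of c "gs ! i" T b]) auto
      then show "?v b ! i = c" using i f(2) by simp
    qed
    then show "app (compose_bf m f gs) b = c" using T by (simp add: app_compose_bf tuples_def)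
  qed
qed

lemma L_affine: "f \<in> L \<Longrightarrow> affine_bf f"
proof -
  have "{xor_bf, const_bf True} \<subseteq> {f \<in> boolfuns. affine_bf f}"
    by (auto simp: xor_bf_def const_bf_def affine_bf_def app_mk tuples_def xor3_def intro!: mk_in_boolfuns)
  then show "f \<in> L \<Longrightarrow> affine_bf f"
    using clone_generated_subset[OF clone_affine_bf] unfolding L_def by blast
qed

lemma const_semilattice_bf: "semilattice_bf c (const_bf d)"
  by (auto simp: semilattice_bf_def const_bf_def app_mk tuples_def subset_iff)

lemma Lambda_semilattice: "f \<in> Lambda \<Longrightarrow> semilattice_bf True f"
proof -
  have "semilattice_bf True and_bf"
    unfolding semilattice_bf_def and_bf_def by (auto simp: app_mk tuples_def subset_iff)
  then have "{and_bf, const_bf False, const_bf True} \<subseteq> {f \<in> boolfuns. semilattice_bf True f}"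
    using const_semilattice_bf by (auto simp: and_bf_def const_bf_def intro!: mk_in_boolfuns)
  then show "f \<in> Lambda \<Longrightarrow> semilattice_bf True f"
    using clone_generated_subset[OF clone_semilattice_bf] unfolding Lambda_def by blast
qed

lemma V_semilattice: "f \<in> V \<Longrightarrow> semilattice_bf False f"
proof -
  have "semilattice_bf False or_bf"
    unfolding semilattice_bf_def or_bf_def by (auto simp: app_mk tuples_def subset_iff)
  then have "{or_bf, const_bf False, const_bf True} \<subseteq> {f \<in> boolfuns. semilattice_bf False f}"
    using const_semilattice_bf by (auto simp: or_bf_def const_bf_def intro!: mk_in_boolfuns)
  then show "f \<in> V \<Longrightarrow> semilattice_bf False f"
    using clone_generated_subset[OF clone_semilattice_bf] unfolding V_def by blast
qed

definition separating_bf :: "bool \<Rightarrow> boolfun \<Rightarrow> bool" where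
  "separating_bf c f \<longleftrightarrow> (\<exists>i<arity f. \<forall>a\<in>tuples (arity f). app f a = c \<longrightarrow> a ! i = c)"

text \<open>Take for \<open>T\<close> the whole preimage of 1: an index where its meet is 1 is a
  separating coordinate.\<close>

lemma U_inf_separating: "f \<in> U_inf \<Longrightarrow> separating_bf True f"
proof -
  assume "f \<in> U_inf"
  then have "meet (arity f) {a \<in> tuples (arity f). app f a} \<noteq> replicate (arity f) False"
    by (auto simp: U_inf_def)
  then show ?thesis
    by (auto simp: meet_def separating_bf_def list_eq_iff_nth_eq)
qed

lemma W_inf_separating: "f \<in> W_inf \<Longrightarrow> separating_bf False f"
proof -
  assume "f \<in> W_inf"
  then have "join (arity f) {a \<in> tuples (arity f). \<not> app f a} \<noteq> replicate (arity f) True"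
    by (auto simp: W_inf_def)
  then show ?thesis
    by (auto simp: join_def separating_bf_def list_eq_iff_nth_eq)
qed

subsection \<open>The test functions\<close>

text \<open>The twist \<open>t\<close> exchanges the roles of 0 and 1 in the arguments, turning \<open>L0\<close> into \<open>L1\<close>.\<close>

definition char_tuple :: "bool \<Rightarrow> nat \<Rightarrow> nat set \<Rightarrow> bool list" where
  "char_tuple t n X = map (\<lambda>i. (i \<in> X) \<noteq> t) [0..<n]"

definition support :: "bool \<Rightarrow> bool list \<Rightarrow> nat set" where
  "support t a = {i. i < length a \<and> a ! i \<noteq> t}"

text \<open>The value \<open>c = True\<close> serves \<open>Lambda\<close> and \<open>U_inf\<close>,
  the value \<open>c = False\<close> serves \<open>V\<close> and \<open>W_inf\<close>.\<close>

definition test_fun :: "bool \<Rightarrow> bool \<Rightarrow> nat \<Rightarrow> boolfun" where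
  "test_fun c t n = mk n (\<lambda>a. (support t a \<in> test_sets n) = c)"

text \<open>The tuple \<open>gs\<close> seen as a map of power sets, tuples being identified with
  their supports, so that rigidity applies.\<close>

definition induced_map :: "bool \<Rightarrow> nat \<Rightarrow> boolfun list \<Rightarrow> nat set \<Rightarrow> nat set" where
  "induced_map t n gs X = support t (map (\<lambda>g. app g (char_tuple t n X)) gs)"

lemma length_char_tuple [simp]: "length (char_tuple t n X) = n"
  by (simp add: char_tuple_def)

lemma support_char_tuple: "X \<subseteq> {..<n} \<Longrightarrow> support t (char_tuple t n X) = X"
  by (auto simp: support_def char_tuple_def)

lemma app_test_fun_char_tuple:
  "X \<subseteq> {..<n} \<Longrightarrow> app (test_fun c t n) (char_tuple t n X) = c \<longleftrightarrow> X \<in> test_sets n"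
  by (auto simp: test_fun_def app_mk support_char_tuple)

lemma app_compose_test_fun:
  "length gs = m \<Longrightarrow> app (compose_bf n (test_fun c t m) gs) (char_tuple t n X) = c \<longleftrightarrow>
     induced_map t n gs X \<in> test_sets m"
  by (auto simp: app_compose_bf test_fun_def app_mk induced_map_def)

lemma test_sets_subset: "X \<in> test_sets n \<Longrightarrow> X \<subseteq> {..<n}"
  by (simp add: test_sets_def)

lemma empty_notin_test_sets: "n > 0 \<Longrightarrow> {} \<notin> test_sets n"
  by (auto simp: test_sets_def lessThan_empty_iff)

lemma full_in_test_sets: "{..<n} \<in> test_sets n"
  by (simp add: test_sets_def)

text \<open>By rigidity, a map that preserves test sets and keeps the empty set off them needs
  arities at most 1 apart. This is the contrapositive.\<close>

lemma induced_map_rigid: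
  assumes gs: "length gs = m" "\<And>g. g \<in> set gs \<Longrightarrow> affine_bf g \<and> arity g = n"
    and test: "\<And>X. X \<in> test_sets n \<Longrightarrow> induced_map t n gs X \<in> test_sets m"
    and large: "200 \<le> n" "200 \<le> m" and far: "n > Suc m \<or> m > Suc n"
  shows "induced_map t n gs {} \<in> test_sets m"
proof (rule ccontr)
  assume "induced_map t n gs {} \<notin> test_sets m"
  moreover have "induced_map t n gs (sym_diff (sym_diff X Y) Z) =
      sym_diff (sym_diff (induced_map t n gs X) (induced_map t n gs Y)) (induced_map t n gs Z)" for X Y Z
  proof -
    \<comment> \<open>Three copies of the twist add up to one, so affinity survives for
      \<open>t = True\<close>.\<close>
    have "char_tuple t n (sym_diff (sym_diff X Y) Z) =
        xor3 (char_tuple t n X) (char_tuple t n Y) (char_tuple t n Z)"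
      by (intro nth_equalityI) (auto simp: char_tuple_def xor3_def)
    then have "app g (char_tuple t n (sym_diff (sym_diff X Y) Z)) =
        (app g (char_tuple t n X) \<noteq> (app g (char_tuple t n Y) \<noteq> app g (char_tuple t n Z)))"
      if "g \<in> set gs" for g
      using gs(2)[OF that] by (simp add: affine_bf_def tuples_def)
    from this[OF nth_mem] show ?thesis by (auto simp: induced_map_def support_def)
  qed
  moreover have "induced_map t n gs {} \<subseteq> {..<m}"
    using gs by (auto simp: induced_map_def support_def)
  ultimately have "n \<le> Suc m \<and> m \<le> Suc n"
    using test large by (intro affine_test_sets_rigid[of n "induced_map t n gs" m]) blast+
  then show False using far by linarith
qed

text \<open>Passing from the empty to the full set complements the tuple, and self-dual functions
  commute with complementation.\<close>

lemma induced_map_full_LS: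
  assumes "\<And>g. g \<in> set gs \<Longrightarrow> self_dual g \<and> arity g = n"
  shows "induced_map t n gs {..<n} = {..<length gs} - induced_map t n gs {}"
proof -
  have "char_tuple t n {..<n} = map Not (char_tuple t n {})"
    by (intro nth_equalityI) (auto simp: char_tuple_def)
  then have "app (gs ! i) (char_tuple t n {..<n}) = (\<not> app (gs ! i) (char_tuple t n {}))"
    if "i < length gs" for i
    using assms[OF nth_mem[OF that]] by (auto simp: self_dual_def tuples_def)
  then show ?thesis by (auto simp: induced_map_def support_def)
qed

text \<open>The complement has \<open>m - 1\<close>, \<open>m - 2\<close> or 0 points, and from
  \<open>m = 5\<close> on none of these is 1, 2 or \<open>m\<close>.\<close>

lemma test_sets_complement:
  assumes "X \<in> test_sets m" "m \<ge> 5"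
  shows "{..<m} - X \<notin> test_sets m"
proof
  assume *: "{..<m} - X \<in> test_sets m"
  have X: "X \<subseteq> {..<m}" using assms by (simp add: test_sets_def)
  have card: "card Z = 1 \<or> card Z = 2 \<or> card Z = m" if "Z \<in> test_sets m" for Z
    using that by (auto simp: test_sets_def)
  have "card ({..<m} - X) = m - card X"
    using X finite_subset by (subst card_Diff_subset) auto
  moreover have "card X \<noteq> 0"
    using assms empty_notin_test_sets[of m] X finite_subset[OF X] by auto
  ultimately show False using card[OF assms(1)] card[OF *] assms(2) by linarith
qed

text \<open>The factor 2 keeps arities more than 1 apart, and the offset 200 meets the size bound in
  \<open>affine_test_sets_rigid\<close>.\<close>

definition test_arity :: "nat \<Rightarrow> nat" where
  "test_arity k = 200 + 2 * k"

lemma test_arity_ge: "200 \<le> test_arity k"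
  by (simp add: test_arity_def)

lemma test_arity_far: "j \<noteq> k \<Longrightarrow> test_arity k > Suc (test_arity j) \<or> test_arity j > Suc (test_arity k)"
  unfolding test_arity_def by presburger

lemma arity_test_fun [simp]: "arity (test_fun c t n) = n"
  by (simp add: test_fun_def)

lemma test_fun_boolfuns: "n \<ge> 1 \<Longrightarrow> test_fun c t n \<in> boolfuns"
  by (simp add: test_fun_def mk_in_boolfuns)

section \<open>Uncountability for semilattice and for separating outer clones\<close>

lemma uncountable_semilattice:
  assumes C1: "clone C1" "C1 \<subseteq> L" and C2: "clone C2" "\<And>u. u \<in> C2 \<Longrightarrow> semilattice_bf c u"
  shows "uncountable {K. clonoid C1 C2 K}"
proof (rule uncountable_clonoids)
  let ?F = "\<lambda>k. test_fun c False (test_arity k)"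
  let ?\<chi> = "\<lambda>k. char_tuple False (test_arity k)"
  \<comment> \<open>Constant functions, which \<open>C2\<close> may contain, satisfy this
    implication, whereas \<open>?F k\<close> violates it because the empty set is not a test
    set.\<close>
  let ?Q = "\<lambda>k. {h. (\<forall>X\<in>test_sets (test_arity k). app h (?\<chi> k X) = c) \<longrightarrow> app h (?\<chi> k {}) = c}"
  show "clone C1" by fact
  show "C2 \<subseteq> boolfuns" using C2 by (simp add: clone_def)
  show "?F k \<in> boolfuns" for k
    using test_arity_ge[of k] by (intro test_fun_boolfuns) simp
  show "?F k \<notin> ?Q k" for k
    using test_arity_ge[of k] empty_notin_test_sets[of "test_arity k"]
    by (auto simp: app_test_fun_char_tuple test_sets_subset)
  show "compose_bf (arity (?F k)) (?F j) gs \<in> ?Q k"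
    if "j \<noteq> k" "length gs = arity (?F j)" "set gs \<subseteq> C1" "\<And>g. g \<in> set gs \<Longrightarrow> arity g = arity (?F k)"
    for j k gs
  proof -
    have "affine_bf g \<and> arity g = test_arity k" if "g \<in> set gs" for g
      using that \<open>set gs \<subseteq> C1\<close> C1 \<open>\<And>g. g \<in> set gs \<Longrightarrow> arity g = arity (?F k)\<close> L_affine
      by (metis arity_test_fun subsetD)
    then show ?thesis
      using induced_map_rigid[of gs "test_arity j" "test_arity k" False] that
        test_arity_ge[of j] test_arity_ge[of k] test_arity_far[of j k]
      by (simp add: app_compose_test_fun)
  qed
  show "compose_bf (arity (?F k)) u hs \<in> ?Q k"
    if u: "u \<in> C2" "length hs = arity u" "set hs \<subseteq> ?Q k" for k u hs
  proof -
    let ?v = "\<lambda>X. map (\<lambda>h. app h (?\<chi> k X)) hs"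
    have "app u (?v {}) = c" if h: "\<forall>X\<in>test_sets (test_arity k). app u (?v X) = c"
    \<comment> \<open>The tuples \<open>?v X\<close> form the set \<open>T\<close>; membership of
      \<open>hs ! i\<close> in \<open>?Q k\<close> is the condition at coordinate
      \<open>i\<close>.\<close>
    proof (rule semilattice_bfD[OF C2(2)[OF u(1)]])
      show "?v ` test_sets (test_arity k) \<noteq> {}" using full_in_test_sets by blast
      show "?v ` test_sets (test_arity k) \<subseteq> tuples (arity u)" "?v {} \<in> tuples (arity u)"
        using u(2) by (auto simp: tuples_def)
      show "app u a = c" if "a \<in> ?v ` test_sets (test_arity k)" for a using h that by blast
      fix i assume i: "i < arity u" and all: "\<And>a. a \<in> ?v ` test_sets (test_arity k) \<Longrightarrow> a ! i = c"
      have "app (hs ! i) (?\<chi> k X) = c" if "X \<in> test_sets (test_arity k)" for X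
        using all[OF imageI[OF that]] i u(2) by simp
      moreover have "hs ! i \<in> set hs" using i u(2) by simp
      then have "hs ! i \<in> ?Q k" using u(3) by (rule subsetD[rotated])
      ultimately have "app (hs ! i) (?\<chi> k {}) = c" by blast
      then show "?v {} ! i = c" using i u(2) by simp
    qed
    then show ?thesis
      unfolding mem_Collect_eq arity_test_fun app_compose_bf[OF length_char_tuple] by blast
  qed
qed

text \<open>If a separating \<open>u\<close> yields \<open>c\<close> on all test sets, so does the
  argument at its separating coordinate; hence failing to be \<open>c\<close> on some test set
  passes to compositions. Rigidity would make the empty set map to a test set, which
  \<open>no_map\<close> excludes.\<close>

lemma uncountable_separating:
  assumes C1: "clone C1" "C1 \<subseteq> L" and C2: "clone C2" "\<And>u. u \<in> C2 \<Longrightarrow> separating_bf c u"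
    and no_map: "\<And>m n gs. \<lbrakk>m \<ge> 5; length gs = m; set gs \<subseteq> C1; \<And>g. g \<in> set gs \<Longrightarrow> arity g = n;
      induced_map t n gs {} \<in> test_sets m; induced_map t n gs {..<n} \<in> test_sets m\<rbrakk> \<Longrightarrow> False"
  shows "uncountable {K. clonoid C1 C2 K}"
proof (rule uncountable_clonoids)
  let ?F = "\<lambda>k. test_fun c t (test_arity k)"
  let ?\<chi> = "\<lambda>k. char_tuple t (test_arity k)"
  let ?Q = "\<lambda>k. {h. \<not> (\<forall>X\<in>test_sets (test_arity k). app h (?\<chi> k X) = c)}"
  show "clone C1" by fact
  show "C2 \<subseteq> boolfuns" using C2 by (simp add: clone_def)
  show "?F k \<in> boolfuns" for k
    using test_arity_ge[of k] by (intro test_fun_boolfuns) simp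
  show "?F k \<notin> ?Q k" for k
    by (auto simp: app_test_fun_char_tuple test_sets_subset)
  show "compose_bf (arity (?F k)) (?F j) gs \<in> ?Q k"
    if "j \<noteq> k" "length gs = arity (?F j)" "set gs \<subseteq> C1" "\<And>g. g \<in> set gs \<Longrightarrow> arity g = arity (?F k)"
    for j k gs
  proof -
    have "affine_bf g \<and> arity g = test_arity k" if "g \<in> set gs" for g
      using that \<open>set gs \<subseteq> C1\<close> C1 \<open>\<And>g. g \<in> set gs \<Longrightarrow> arity g = arity (?F k)\<close> L_affine
      by (metis arity_test_fun subsetD)
    then have "induced_map t (test_arity k) gs {} \<in> test_sets (test_arity j)"
      if "\<forall>X\<in>test_sets (test_arity k). induced_map t (test_arity k) gs X \<in> test_sets (test_arity j)"
      using induced_map_rigid[of gs "test_arity j" "test_arity k" t] that \<open>j \<noteq> k\<close>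
        \<open>length gs = arity (?F j)\<close> test_arity_ge[of j] test_arity_ge[of k] test_arity_far[of j k]
      by simp
    then have "\<not> (\<forall>X\<in>test_sets (test_arity k). induced_map t (test_arity k) gs X \<in> test_sets (test_arity j))"
      using no_map[of "test_arity j" gs "test_arity k"] that test_arity_ge[of j]
        full_in_test_sets[of "test_arity k"] by force
    then show ?thesis
      using that(2) app_compose_test_fun[of gs "test_arity j" "test_arity k" c t] by auto
  qed
  show "compose_bf (arity (?F k)) u hs \<in> ?Q k"
    if u: "u \<in> C2" "length hs = arity u" "set hs \<subseteq> ?Q k" for k u hs
  proof -
    obtain i where i: "i < arity u" "\<forall>a\<in>tuples (arity u). app u a = c \<longrightarrow> a ! i = c"
      using C2(2)[OF u(1)] unfolding separating_bf_def by blast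
    have "hs ! i \<in> set hs" using i u(2) by simp
    then have "hs ! i \<in> ?Q k" using u(3) by (rule subsetD[rotated])
    then obtain X where X: "X \<in> test_sets (test_arity k)" "app (hs ! i) (?\<chi> k X) \<noteq> c" by blast
    let ?v = "map (\<lambda>h. app h (?\<chi> k X)) hs"
    have "?v \<in> tuples (arity u)" "?v ! i \<noteq> c"
      using i(1) X(2) u(2) by (simp_all add: tuples_def)
    then have "app u ?v \<noteq> c" using i(2) by blast
    then show ?thesis using X by (auto simp: app_compose_bf)
  qed
qed

lemma uncountable_separating_L0_L1_LS:
  assumes "clone C1" "C1 \<subseteq> L0 \<or> C1 \<subseteq> L1 \<or> C1 \<subseteq> LS"
    and "clone C2" "\<And>u. u \<in> C2 \<Longrightarrow> separating_bf c u"
  shows "uncountable {K. clonoid C1 C2 K}"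
proof -
  have C1_L: "C1 \<subseteq> L" using assms(2) by (auto simp: L0_def L1_def LS_def)
  \<comment> \<open>\<open>L0\<close> gives \<open>t = False\<close> and \<open>L1\<close> gives
    \<open>t = True\<close>.\<close>
  from assms(2) consider t where "\<And>g. g \<in> C1 \<Longrightarrow> app g (replicate (arity g) t) = t" | "C1 \<subseteq> LS"
    by (auto simp: L0_def L1_def)
  then show ?thesis
  proof cases
    case (1 t)
    show ?thesis
    proof (rule uncountable_separating[OF assms(1) C1_L assms(3,4), where t = t])
      fix m n gs assume *: "m \<ge> (5::nat)" "length gs = m" "set gs \<subseteq> C1" "\<And>g. g \<in> set gs \<Longrightarrow> arity g = n"
        "induced_map t n gs {} \<in> test_sets m"
      \<comment> \<open>Under this twist the constant tuple that \<open>C1\<close> preserves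
        represents the empty set, so the induced map fixes the empty set.\<close>
      have "char_tuple t n {} = replicate n t"
        by (intro nth_equalityI) (auto simp: char_tuple_def)
      then have "app g (char_tuple t n {}) = t" if "g \<in> set gs" for g
        using 1[of g] that *(3,4) by auto
      then have "induced_map t n gs {} = {}" by (auto simp: induced_map_def support_def)
      then show False using * empty_notin_test_sets[of m] by simp
    qed
  next
    case 2
    show ?thesis
    proof (rule uncountable_separating[OF assms(1) C1_L assms(3,4), where t = False])
      fix m n gs assume *: "m \<ge> (5::nat)" "length gs = m" "set gs \<subseteq> C1" "\<And>g. g \<in> set gs \<Longrightarrow> arity g = n"
        "induced_map False n gs {} \<in> test_sets m" "induced_map False n gs {..<n} \<in> test_sets m"
      \<comment> \<open>The empty and the full set now have complementary images, which cannot both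
        be test sets.\<close>
      have "self_dual g \<and> arity g = n" if "g \<in> set gs" for g
        using that * 2 by (auto simp: LS_def)
      then show False
        using induced_map_full_LS[of gs n False] test_sets_complement[OF *(5,1)] * by auto
    qed
  qed
qed

theorem theorem3p1:
  fixes C1 C2 :: "boolfun set"
  assumes "clone C1" and "clone C2"
    and "\<exists>(K1, K2) \<in> {(L, Lambda), (L0, U_inf), (L1, U_inf), (LS, U_inf),
                         (L, V), (L0, W_inf), (L1, W_inf), (LS, W_inf)}.
           C1 \<subseteq> K1 \<and> C2 \<subseteq> K2"
  shows "uncountable {K. clonoid C1 C2 K}"
proof -
  from assms(3) consider "C1 \<subseteq> L" "C2 \<subseteq> Lambda" | "C1 \<subseteq> L" "C2 \<subseteq> V"
    | "C1 \<subseteq> L0 \<or> C1 \<subseteq> L1 \<or> C1 \<subseteq> LS" "C2 \<subseteq> U_inf"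
    | "C1 \<subseteq> L0 \<or> C1 \<subseteq> L1 \<or> C1 \<subseteq> LS" "C2 \<subseteq> W_inf"
    by auto
  then show ?thesis
  proof cases
    case 1
    then show ?thesis using uncountable_semilattice assms(1,2) Lambda_semilattice by blast
  next
    case 2
    then show ?thesis using uncountable_semilattice assms(1,2) V_semilattice by blast
  next
    case 3
    then show ?thesis
      using uncountable_separating_L0_L1_LS[OF assms(1) _ assms(2)] U_inf_separating by blast
  next
    case 4
    then show ?thesis
      using uncountable_separating_L0_L1_LS[OF assms(1) _ assms(2)] W_inf_separating by blast
  qed
qed

end
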